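(* Let $c,\varepsilon\in\{1,-1\}$, let $\gamma\in\mathbb{Q}$ with $q^\gamma\in\mathbb{F}$, and let $L=\sum_{i=0}^{J}a_i(q^k)\sigma^i$ with $a_i(x)\in\mathbb{F}[x,x^{-1}]$ be an operator of order $J$ which is nondegenerated and $q$-power-partible with respect to $(\gamma,\varepsilon)$. Let $Q\in S_{\gamma}^{\langle c\rangle}$. Then there exist $p\in S_{\gamma,\gamma-J}^{\langle c\varepsilon\rangle}$ and $\tilde Q\in S_\gamma^{\langle c\rangle}$ with $\deg\tilde Q\le\deg L$ such that $$Q=L^{\ast}(p)+\tilde Q.$$ Moreover, when $c\varepsilon=1$, $p$ and $\tilde Q$ can be chosen so that in addition $\deg\tilde Q<\deg L$.
   Context: $\mathbb{K}$ is a field of characteristic zero, $q$ an indeterminate, and $\mathbb{F}=\mathbb{K}(q^{1/n})$ for some positive integer $n$. $\sigma$ is the shift in $k$ ($\sigma q^k=q^{k+1}\sigma$). Laurent polynomials in $q^k$ are identified with Laurent polynomials in $x$ via $x=q^k$. For $L=\sum_{i=0}^{J}a_i(q^k)\sigma^i$ put $L^{\ast}(p(x))=\sum_{i=0}^{J}a_i(q^{-i}x)\,p(q^{-i}x)$. $L$ (with $a_0a_J\ne0$) is $q$-power-partible with respect to $(\gamma,\varepsilon)$ if $a_i(q^{\gamma}q^k)=\varepsilon\,a_{J-i}(q^{\gamma-J}q^{-k})$ for all $k\in\mathbb{Z}$ and $i=0,1,\dots,J$; equivalently $a_i(q^\gamma x)=\varepsilon\, a_{J-i}(q^{\gamma-J}x^{-1})$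 in $\mathbb{F}[x,x^{-1}]$. For $q^\gamma,q^\delta\in\mathbb{F}$ and $c\in\{1,-1\}$, $S_{\gamma,\delta}^{\langle c\rangle}=\{Q(x)\in\mathbb{F}[x,x^{-1}] : Q(q^\gamma x)=c\,Q(q^{\delta}x^{-1})\}$, and $S_\gamma^{\langle c\rangle}=S_{\gamma,\gamma}^{\langle c\rangle}$. For a Laurent polynomial $a(x)$, $\operatorname{hdeg}a$ and $\operatorname{ldeg}a$ are the highest and lowest degree of $x$ in $a$, and $\deg a=\operatorname{hdeg}a-\operatorname{ldeg}a$ ($\operatorname{hdeg}0=-\infty$, $\operatorname{ldeg}0=+\infty$, $\deg0=-\infty$). $\operatorname{hdeg}L=\max_i\operatorname{hdeg}a_i$, $\operatorname{ldeg}L=\min_i\operatorname{ldeg}a_i$, $\deg L=\operatorname{hdeg}L-\operatorname{ldeg}L$. With $[x^t](a(x))$ the coefficient of $x^t$ in $a(x)$, put $f_L^{(t)}(s)=\sum_{i=0}^{J}[x^{t}](a_i(q^{-i}x))\,q^{-si}$ and $R_L^{t}=\{s\in\mathbb{Z}: f_L^{(t)}(s)=0\}$; $L$ is nondegenerated if $R_L^{\operatorname{hdeg}L}=R_L^{\operatorname{ldeg}L}=\emptyset$. *)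

theory Defs
  imports
    "HOL-Computational_Algebra.Computational_Algebra"
    "HOL-Library.Poly_Mapping"
    "HOL-Library.Extended"
begin

section \<open>The field \<open>F = K(q\<^sup>1\<^sup>/\<^sup>n)\<close> and powers of \<open>q\<close>\<close>

text \<open>
  \<open>F\<close> is the field of rational functions over \<open>K\<close> in one variable, and that variable stands for
  \<open>q\<^sup>1\<^sup>/\<^sup>n\<close>. Hence \<open>q\<close> itself is its \<open>n\<close>-th power, and \<open>n\<close> is a parameter of everything involving \<open>q\<close>.
\<close>

type_synonym 'k ratfun = "'k poly fract"

definition qroot :: "'k::field ratfun" where
  "qroot = Fract [:0, 1:] 1"

text \<open>
  \<open>q\<^sup>\<gamma> \<in> F\<close> means that \<open>q\<^sup>\<gamma>\<close> is an integer power of \<open>q\<^sup>1\<^sup>/\<^sup>n\<close>; if so, \<open>qexp n \<gamma>\<close> is its value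
  (otherwise it has no meaning).
  The lemmas \<open>qexp_in_field_iff\<close> and \<open>qexp_power\<close> justify this: for \<open>\<gamma> = a / b\<close>
  in lowest terms, the condition is equivalent to \<open>F\<close> containing some \<open>b\<close>-th root of \<open>q\<^sup>a\<close>,
  and \<open>qexp n \<gamma>\<close> is such a root.
\<close>

definition qexp_in_field :: "nat \<Rightarrow> rat \<Rightarrow> bool" where
  "qexp_in_field n \<gamma> \<longleftrightarrow> of_nat n * \<gamma> \<in> \<int>"

definition qexp :: "nat \<Rightarrow> rat \<Rightarrow> 'k::field ratfun" where
  "qexp n \<gamma> = qroot powi \<lfloor>of_nat n * \<gamma>\<rfloor>"

lemma qroot_nonzero [simp]: "(qroot :: 'k::field ratfun) \<noteq> 0"
  by (simp add: qroot_def Zero_fract_def eq_fract)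

lemma qexp_of_int: "qexp n (of_int a) = (qroot ^ n) powi a"
proof -
  have "\<lfloor>of_nat n * (of_int a :: rat)\<rfloor> = int n * a"
    by (metis floor_of_int of_int_mult of_int_of_nat_eq)
  thus ?thesis
    by (simp add: qexp_def power_int_mult)
qed

lemma qexp_power:
  assumes "quotient_of \<gamma> = (a, b)" and "qexp_in_field n \<gamma>"
  shows "(qexp n \<gamma>) ^ nat b = qexp n (of_int a)"
proof -
  have b: "b > 0" and g: "\<gamma> = of_int a / of_int b"
    using assms(1) quotient_of_denom_pos quotient_of_div by auto
  obtain z where z: "of_nat n * \<gamma> = of_int z"
    using assms(2) by (auto simp: qexp_in_field_def elim: Ints_cases)
  have "of_int (int n * a) = (of_int (z * b) :: rat)"
    using z b by (simp add: g field_simps)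
  hence zb: "z * b = int n * a"
    by (simp only: of_int_eq_iff)
  have "(qexp n \<gamma>) ^ nat b = (qroot powi (z * b) :: 'a ratfun)"
    using b by (simp add: qexp_def z power_int_mult power_int_def[of _ b])
  also have "\<dots> = qexp n (of_int a)"
    by (simp add: zb qexp_of_int power_int_mult)
  finally show ?thesis .
qed

lemma root_of_qroot_power:
  fixes u :: "'k::field ratfun"
  assumes "u ^ b = qroot ^ m"
  shows "b dvd m"
proof -
  obtain r s :: "'k poly" where u: "u = Fract r s" and s: "s \<noteq> 0"
    by (cases u) auto
  have frpow: "Fract x y ^ k = Fract (x ^ k) (y ^ k)" for x y :: "'k poly" and k
    by (induction k) (simp_all add: One_fract_def)
  have eq: "r ^ b = s ^ b * [:0, 1:] ^ m"
    using assms s by (simp add: u qroot_def frpow eq_fract mult.commute)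
  have r: "r ^ b \<noteq> 0"
    using s by (simp add: eq)
  have opow: "order 0 (p ^ k) = k * order 0 p" if "p \<noteq> 0" for p :: "'k poly" and k
    by (induction k) (use that in \<open>simp_all add: order_mult\<close>)
  have rb: "order 0 (r ^ b) = b * order 0 r"
    using r opow[of r b] by (cases "b = 0") auto
  have "order 0 ([:0, 1:] ^ m :: 'k poly) = m"
    using order_power_n_n[of "0::'k" m] by simp
  hence "b * order 0 r = b * order 0 s + m"
    using rb r s eq opow[of s b] by (simp add: order_mult)
  thus ?thesis
    by (metis dvd_add_right_iff dvd_triv_left)
qed

lemma qexp_in_field_iff:
  assumes "quotient_of \<gamma> = (a, b)"
  shows "qexp_in_field n \<gamma> \<longleftrightarrow> (\<exists>u :: 'k::field ratfun. u ^ nat b = qexp n (of_int a))"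
proof
  assume "qexp_in_field n \<gamma>"
  from qexp_power[OF assms this] show "\<exists>u :: 'k ratfun. u ^ nat b = qexp n (of_int a)" by blast
next
  assume "\<exists>u :: 'k ratfun. u ^ nat b = qexp n (of_int a)"
  then obtain u :: "'k ratfun" where u: "u ^ nat b = (qroot ^ n) powi a"
    by (auto simp: qexp_of_int)
  have b: "b > 0" and g: "\<gamma> = of_int a / of_int b"
    using assms quotient_of_denom_pos quotient_of_div by auto
  have "nat b dvd n * nat \<bar>a\<bar>"
  proof (cases "a \<ge> 0")
    case True
    thus ?thesis using u by (intro root_of_qroot_power[of u])
      (simp add: power_int_def power_mult)
  next
    case False
    hence "inverse u ^ nat b = qroot ^ (n * nat \<bar>a\<bar>)"
      using u by (simp add: power_int_def power_mult power_inverse)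
    thus ?thesis by (rule root_of_qroot_power)
  qed
  hence "int (nat b) dvd int (n * nat \<bar>a\<bar>)"
    by (simp only: int_dvd_int_iff)
  hence "b dvd \<bar>int n * a\<bar>"
    using b by (simp add: abs_mult)
  hence "b dvd int n * a"
    by simp
  then obtain z where "int n * a = b * z" ..
  hence "of_int (int n * a) = (of_int (b * z) :: rat)"
    by simp
  hence "of_nat n * \<gamma> = of_int z"
    using b by (simp add: g field_simps)
  thus "qexp_in_field n \<gamma>"
    by (simp add: qexp_in_field_def)
qed

section \<open>Laurent polynomials\<close>

text \<open>\<open>F[x, x\<^sup>-\<^sup>1]\<close> as the ring of finitely supported functions \<open>\<int> \<Rightarrow> F\<close> under convolution.\<close>

type_synonym 'a laurent = "int \<Rightarrow>\<^sub>0 'a"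

definition lp_eval :: "'a::field laurent \<Rightarrow> 'a \<Rightarrow> 'a" where
  "lp_eval Q y = (\<Sum>m\<in>Poly_Mapping.keys Q. Poly_Mapping.lookup Q m * y powi m)"

text \<open>\<open>lp_subst u e Q\<close> is \<open>Q(u x\<^sup>e)\<close>; it is used for \<open>u \<noteq> 0\<close> and \<open>e \<in> {1, -1}\<close>.\<close>

definition lp_subst :: "'a::field \<Rightarrow> int \<Rightarrow> 'a laurent \<Rightarrow> 'a laurent" where
  "lp_subst u e Q =
     (\<Sum>m\<in>Poly_Mapping.keys Q. Poly_Mapping.single (e * m) (Poly_Mapping.lookup Q m * u powi m))"

definition lp_const :: "'a::field \<Rightarrow> 'a laurent" where
  "lp_const c = Poly_Mapping.single 0 c"

definition hdeg :: "'a::zero laurent \<Rightarrow> int extended" where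
  "hdeg Q = (if Q = 0 then Minf else Fin (Max (Poly_Mapping.keys Q)))"

definition ldeg :: "'a::zero laurent \<Rightarrow> int extended" where
  "ldeg Q = (if Q = 0 then Pinf else Fin (Min (Poly_Mapping.keys Q)))"

text \<open>For \<open>Q = 0\<close> this is \<open>Minf - Pinf = Minf\<close>.\<close>

definition deg :: "'a::zero laurent \<Rightarrow> int extended" where
  "deg Q = hdeg Q - ldeg Q"

definition S_set :: "nat \<Rightarrow> rat \<Rightarrow> rat \<Rightarrow> 'k::field ratfun \<Rightarrow> 'k ratfun laurent set" where
  "S_set n \<gamma> \<delta> c =
     {Q. lp_subst (qexp n \<gamma>) 1 Q = lp_const c * lp_subst (qexp n \<delta>) (-1) Q}"

section \<open>Operators\<close>

text \<open>
  The operator \<open>L = (\<Sum>i=0..J. a\<^sub>i(q\<^sup>k) \<sigma>\<^sup>i)\<close> is given by its coefficients \<open>a\<close> and by \<open>J\<close>;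
  the values of \<open>a\<close> beyond \<open>J\<close> are irrelevant.
\<close>

definition L_star ::
    "nat \<Rightarrow> nat \<Rightarrow> (nat \<Rightarrow> 'k::field ratfun laurent) \<Rightarrow> 'k ratfun laurent \<Rightarrow> 'k ratfun laurent" where
  "L_star n J a p =
     (\<Sum>i\<le>J. lp_subst (qexp n (- of_nat i)) 1 (a i) * lp_subst (qexp n (- of_nat i)) 1 p)"

definition q_power_partible ::
    "nat \<Rightarrow> nat \<Rightarrow> (nat \<Rightarrow> 'k::field ratfun laurent) \<Rightarrow> rat \<Rightarrow> 'k ratfun \<Rightarrow> bool" where
  "q_power_partible n J a \<gamma> \<epsilon> \<longleftrightarrow>
     a 0 \<noteq> 0 \<and> a J \<noteq> 0 \<and>
     (\<forall>k::int. \<forall>i\<le>J.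
        lp_eval (a i) (qexp n \<gamma> * qexp n (of_int k)) =
        \<epsilon> * lp_eval (a (J - i)) (qexp n (\<gamma> - of_nat J) * qexp n (of_int (- k))))"

definition hdeg_op :: "nat \<Rightarrow> (nat \<Rightarrow> 'a::zero laurent) \<Rightarrow> int extended" where
  "hdeg_op J a = Max ((\<lambda>i. hdeg (a i)) ` {..J})"

definition ldeg_op :: "nat \<Rightarrow> (nat \<Rightarrow> 'a::zero laurent) \<Rightarrow> int extended" where
  "ldeg_op J a = Min ((\<lambda>i. ldeg (a i)) ` {..J})"

definition deg_op :: "nat \<Rightarrow> (nat \<Rightarrow> 'a::zero laurent) \<Rightarrow> int extended" where
  "deg_op J a = hdeg_op J a - ldeg_op J a"

definition f_op ::
    "nat \<Rightarrow> nat \<Rightarrow> (nat \<Rightarrow> 'k::field ratfun laurent) \<Rightarrow> int \<Rightarrow> int \<Rightarrow> 'k ratfun" where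
  "f_op n J a t s =
     (\<Sum>i\<le>J. Poly_Mapping.lookup (lp_subst (qexp n (- of_nat i)) 1 (a i)) t * qexp n (of_int (- (s * int i))))"

definition R_op :: "nat \<Rightarrow> nat \<Rightarrow> (nat \<Rightarrow> 'k::field ratfun laurent) \<Rightarrow> int \<Rightarrow> int set" where
  "R_op n J a t = {s. f_op n J a t s = 0}"

text \<open>The degrees of a nonzero operator are finite, so each implication has exactly one relevant \<open>t\<close>.\<close>

definition nondegenerated :: "nat \<Rightarrow> nat \<Rightarrow> (nat \<Rightarrow> 'k::field ratfun laurent) \<Rightarrow> bool" where
  "nondegenerated n J a \<longleftrightarrow>
     (\<forall>t. hdeg_op J a = Fin t \<longrightarrow> R_op n J a t = {}) \<and>
     (\<forall>t. ldeg_op J a = Fin t \<longrightarrow> R_op n J a t = {})"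

end

theory Submission
  imports Defs
begin

text \<open>
  Put \<open>g = q\<^sup>\<gamma>\<close>. The theorem is a division with remainder in which the multiples of the divisor are
  the values of \<open>L\<^sup>*\<close>, and it is triangular for two reasons.

  First, \<open>L\<^sup>*\<close> respects the symmetries: substituting \<open>g x\<close> into the \<open>i\<close>-th summand of \<open>L\<^sup>*(p)\<close> and
  applying the symmetries of \<open>a\<^sub>i\<close> and of \<open>p\<close> gives \<open>\<plusminus>\<close> the \<open>(J-i)\<close>-th summand at \<open>g x\<^sup>-\<^sup>1\<close>.
  Hence \<open>L\<^sup>*\<close> maps \<open>S\<^sub>\<gamma>\<^sub>,\<^sub>\<gamma>\<^sub>-\<^sub>J\<close> with sign \<open>c\<epsilon>\<close> into \<open>S\<^sub>\<gamma>\<close> with sign \<open>c\<close> (\<open>L_star_in_S_set\<close>), so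
  whatever is subtracted from \<open>Q\<close> leaves an element of \<open>S\<^sub>\<gamma>\<close>.

  Second, nondegeneracy controls degrees: if \<open>h\<close> is the highest degree of \<open>L\<close> and \<open>p\<close> has highest
  degree \<open>s\<close>, the coefficient of \<open>x\<^sup>h\<^sup>+\<^sup>s\<close> in \<open>L\<^sup>*(p)\<close> is the leading coefficient of \<open>p\<close> times
  \<open>f_op n J a h s\<close>, which does not vanish (\<open>L_star_leading_coeff\<close>). The source space contains an
  element of highest degree \<open>s\<close>, namely \<open>x\<^sup>s\<close> plus a multiple of \<open>x\<^sup>-\<^sup>s\<close>, for every \<open>s \<ge> 1\<close>, and
  the constant \<open>1\<close> if its sign \<open>c\<epsilon>\<close> is \<open>1\<close> (\<open>S_set_has_degree\<close>). So all terms of \<open>Q\<close> of degree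
  above \<open>h\<close>, respectively from \<open>h\<close> on, can be cancelled from the top (\<open>triangular_reduction\<close>).

  Only high degrees need attention, because the supports of the elements of \<open>S\<^sub>\<gamma>\<close> and of \<open>L\<close> as a
  whole are symmetric about \<open>0\<close>: the degree of \<open>L\<close> is \<open>2h\<close>, and a bound on the highest degree of
  the remainder bounds its lowest degree as well.
\<close>

section \<open>Coefficients of Laurent polynomials\<close>

abbreviation lp_coeff :: "'a::zero laurent \<Rightarrow> int \<Rightarrow> 'a" where
  "lp_coeff \<equiv> Poly_Mapping.lookup"

lemma sum_over_keys:
  assumes "finite I" "Poly_Mapping.keys A \<subseteq> I" "\<And>i. lp_coeff A i = 0 \<Longrightarrow> f i = 0"
  shows "sum f (Poly_Mapping.keys A) = sum f I"
  by (rule sum.mono_neutral_left) (use assms in \<open>auto simp: in_keys_iff\<close>)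

lemma lp_coeff_mult:
  fixes A B :: "'a::comm_semiring_0 laurent"
  assumes "finite I" "Poly_Mapping.keys A \<subseteq> I"
  shows "lp_coeff (A * B) m = (\<Sum>i\<in>I. lp_coeff A i * lp_coeff B (m - i))"
proof -
  have "(\<Sum>q. lp_coeff B q when m = l + q) = lp_coeff B (m - l)" for l
  proof -
    have "(\<Sum>q. lp_coeff B q when m = l + q) = (\<Sum>q. lp_coeff B q when q = m - l)"
      by (rule Sum_any.cong) (auto simp: when_def)
    thus ?thesis by simp
  qed
  hence "lp_coeff (A * B) m = (\<Sum>l. lp_coeff A l * lp_coeff B (m - l))"
    by (simp add: lookup_mult)
  also have "\<dots> = (\<Sum>i\<in>I. lp_coeff A i * lp_coeff B (m - i))"
    by (rule Sum_any.expand_superset) (use assms in \<open>auto simp: in_keys_iff subset_iff dest!: mult_not_zero\<close>)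
  finally show ?thesis .
qed

lemma lp_coeff_const_mult: "lp_coeff (lp_const c * A) m = c * lp_coeff A m"
  by (subst lp_coeff_mult[of "{0}"]) (auto simp: lp_const_def)

lemma lp_const_mult: "lp_const (c * d) = lp_const c * lp_const d"
  by (simp add: lp_const_def mult_single)

lemma lp_coeff_mult_top:
  fixes A B :: "'a::comm_semiring_0 laurent"
  assumes A: "\<And>m. m > h \<Longrightarrow> lp_coeff A m = 0" and B: "\<And>m. m > s \<Longrightarrow> lp_coeff B m = 0"
  shows "lp_coeff (A * B) (h + s) = lp_coeff A h * lp_coeff B s"
    and "m > h + s \<Longrightarrow> lp_coeff (A * B) m = 0"
proof -
  let ?I = "insert h (Poly_Mapping.keys A)"
  have zero: "lp_coeff A i * lp_coeff B (m - i) = 0" if "m \<ge> h + s" "m > h + s \<or> i \<noteq> h" for i m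
    using that A[of i] B[of "m - i"] by (cases "i > h") auto
  show "lp_coeff (A * B) m = 0" if "m > h + s"
    using that zero by (subst lp_coeff_mult[of ?I]) (auto intro!: sum.neutral)
  have "lp_coeff (A * B) (h + s) = (\<Sum>i\<in>?I. lp_coeff A i * lp_coeff B (h + s - i))"
    by (rule lp_coeff_mult) auto
  also have "\<dots> = (\<Sum>i\<in>{h}. lp_coeff A i * lp_coeff B (h + s - i))"
    by (rule sum.mono_neutral_right) (use zero[of "h + s"] in auto)
  finally show "lp_coeff (A * B) (h + s) = lp_coeff A h * lp_coeff B s"
    by simp
qed

section \<open>Substitution and evaluation\<close>

lemma lp_coeff_subst:
  assumes "e \<in> {1, -1}"
  shows "lp_coeff (lp_subst u e Q) m = lp_coeff Q (e * m) * u powi (e * m)"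
proof -
  have "lp_coeff (lp_subst u e Q) m =
      (\<Sum>i\<in>Poly_Mapping.keys Q. if i = e * m then lp_coeff Q i * u powi i else 0)"
    unfolding lp_subst_def lookup_sum lookup_single
    by (rule sum.cong) (use assms in \<open>auto simp: when_def\<close>)
  thus ?thesis
    by (simp add: in_keys_iff)
qed

lemma lp_subst_sum:
  assumes "e \<in> {1, -1}"
  shows "lp_subst u e (\<Sum>i\<in>I. f i) = (\<Sum>i\<in>I. lp_subst u e (f i))"
  by (rule poly_mapping_eqI) (simp add: lp_coeff_subst[OF assms] lookup_sum sum_distrib_right)

lemma lp_subst_add:
  assumes "e \<in> {1, -1}"
  shows "lp_subst u e (A + B) = lp_subst u e A + lp_subst u e B"
  by (rule poly_mapping_eqI) (simp add: lp_coeff_subst[OF assms] lookup_add algebra_simps)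

lemma lp_subst_const_mult:
  assumes "e \<in> {1, -1}"
  shows "lp_subst u e (lp_const c * A) = lp_const c * lp_subst u e A"
  by (rule poly_mapping_eqI) (simp add: lp_coeff_subst[OF assms] lp_coeff_const_mult)

lemma lp_subst_mult:
  assumes e: "e \<in> {1, -1}" and u: "u \<noteq> 0"
  shows "lp_subst u e (A * B) = lp_subst u e A * lp_subst u e B"
proof (rule poly_mapping_eqI)
  fix m
  have ee: "e * (e * i) = i" for i
    using e by auto
  have "lp_coeff (lp_subst u e A * lp_subst u e B) m =
      (\<Sum>j\<in>(\<lambda>i. e * i) ` Poly_Mapping.keys A.
         lp_coeff (lp_subst u e A) j * lp_coeff (lp_subst u e B) (m - j))"
  proof (rule lp_coeff_mult)
    show "Poly_Mapping.keys (lp_subst u e A) \<subseteq> (\<lambda>i. e * i) ` Poly_Mapping.keys A"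
    proof
      fix j assume "j \<in> Poly_Mapping.keys (lp_subst u e A)"
      hence "e * j \<in> Poly_Mapping.keys A"
        by (auto simp: in_keys_iff lp_coeff_subst[OF e])
      thus "j \<in> (\<lambda>i. e * i) ` Poly_Mapping.keys A"
        using ee by (metis image_eqI)
    qed
  qed auto
  also have "\<dots> = (\<Sum>i\<in>Poly_Mapping.keys A.
      (lp_coeff A i * u powi i) * (lp_coeff B (e * m - i) * u powi (e * m - i)))"
    by (subst sum.reindex)
       (use e in \<open>auto simp: inj_on_def lp_coeff_subst[OF e] ee right_diff_distrib intro!: sum.cong\<close>)
  also have "\<dots> = (\<Sum>i\<in>Poly_Mapping.keys A. lp_coeff A i * lp_coeff B (e * m - i)) * u powi (e * m)"
    unfolding sum_distrib_right
    by (rule sum.cong) (use u in \<open>auto simp: power_int_diff\<close>)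
  also have "\<dots> = lp_coeff (lp_subst u e (A * B)) m"
    by (simp add: lp_coeff_subst[OF e] lp_coeff_mult[of "Poly_Mapping.keys A" A])
  finally show "lp_coeff (lp_subst u e (A * B)) m = lp_coeff (lp_subst u e A * lp_subst u e B) m" ..
qed

lemma lp_subst_subst:
  assumes "e \<in> {1, -1}" "f \<in> {1, -1}"
  shows "lp_subst u e (lp_subst v f P) = lp_subst (v * u powi f) (e * f) P"
proof (rule poly_mapping_eqI)
  fix m
  have ef: "e * f \<in> {1, -1}" and ff: "f * (e * f * m) = e * m"
    using assms by auto
  have "(u powi f) powi (e * f * m) = u powi (e * m)"
    by (simp only: ff flip: power_int_mult)
  thus "lp_coeff (lp_subst u e (lp_subst v f P)) m = lp_coeff (lp_subst (v * u powi f) (e * f) P) m"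
    using assms
    by (simp only: lp_coeff_subst[OF ef] lp_coeff_subst power_int_mult_distrib)
       (simp add: mult_ac)
qed

lemma lp_eval_subst:
  assumes "e \<in> {1, -1}"
  shows "lp_eval (lp_subst u e Q) y = lp_eval Q (u * y powi e)"
proof -
  have ee: "e * (e * i) = i" for i
    using assms by auto
  have "lp_eval (lp_subst u e Q) y =
      (\<Sum>j\<in>(\<lambda>i. e * i) ` Poly_Mapping.keys Q. lp_coeff (lp_subst u e Q) j * y powi j)"
    unfolding lp_eval_def
  proof (rule sum_over_keys)
    show "Poly_Mapping.keys (lp_subst u e Q) \<subseteq> (\<lambda>i. e * i) ` Poly_Mapping.keys Q"
    proof
      fix j assume "j \<in> Poly_Mapping.keys (lp_subst u e Q)"
      hence "e * j \<in> Poly_Mapping.keys Q"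
        by (auto simp: in_keys_iff lp_coeff_subst[OF assms])
      thus "j \<in> (\<lambda>i. e * i) ` Poly_Mapping.keys Q"
        using ee by (metis image_eqI)
    qed
  qed auto
  also have "\<dots> = (\<Sum>i\<in>Poly_Mapping.keys Q. lp_coeff Q i * u powi i * y powi (e * i))"
    by (subst sum.reindex)
       (use assms in \<open>auto simp: inj_on_def lp_coeff_subst[OF assms] ee intro!: sum.cong\<close>)
  also have "\<dots> = lp_eval Q (u * y powi e)"
    by (simp add: lp_eval_def power_int_mult_distrib power_int_mult mult.assoc)
  finally show ?thesis .
qed

lemma lp_eval_const_mult: "lp_eval (lp_const c * Q) y = c * lp_eval Q y"
proof -
  have "lp_eval (lp_const c * Q) y =
      (\<Sum>m\<in>Poly_Mapping.keys Q. lp_coeff (lp_const c * Q) m * y powi m)"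
    unfolding lp_eval_def
    by (rule sum_over_keys) (auto simp: in_keys_iff lp_coeff_const_mult)
  thus ?thesis
    by (simp add: lp_eval_def lp_coeff_const_mult sum_distrib_left mult.assoc)
qed

lemma lp_eval_diff: "lp_eval (A - B) y = lp_eval A y - lp_eval B y"
proof -
  let ?I = "Poly_Mapping.keys A \<union> Poly_Mapping.keys B"
  have "lp_eval C y = (\<Sum>m\<in>?I. lp_coeff C m * y powi m)"
    if "Poly_Mapping.keys C \<subseteq> ?I" for C
    unfolding lp_eval_def by (rule sum_over_keys) (use that in auto)
  moreover have "Poly_Mapping.keys (A - B) \<subseteq> ?I"
    by (auto simp: in_keys_iff lookup_minus)
  ultimately show ?thesis
    by (simp add: lookup_minus left_diff_distrib sum_subtractf)
qed

text \<open>
  After multiplication by a power of \<open>y\<close>, a Laurent polynomial becomes an ordinary polynomial,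
  and a nonzero one has finitely many roots.
\<close>

lemma lp_eqI_eval:
  assumes "infinite Y" "0 \<notin> Y" and eq: "\<And>y. y \<in> Y \<Longrightarrow> lp_eval A y = lp_eval B y"
  shows "A = B"
proof -
  define D where "D = A - B"
  define N where "N = Min (Poly_Mapping.keys D)"
  have N: "N \<le> m" if "m \<in> Poly_Mapping.keys D" for m
    using that by (simp add: N_def)
  define P where "P = (\<Sum>m\<in>Poly_Mapping.keys D. monom (lp_coeff D m) (nat (m - N)))"
  have "poly P y = 0" if "y \<in> Y" for y
  proof -
    have y: "y \<noteq> 0" using that assms(2) by auto
    have "poly P y * y powi N = (\<Sum>m\<in>Poly_Mapping.keys D. lp_coeff D m * y powi m)"
      unfolding P_def poly_sum sum_distrib_right
    proof (rule sum.cong)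
      fix m assume "m \<in> Poly_Mapping.keys D"
      hence "y powi (m - N) = y ^ nat (m - N)"
        using N by (simp add: power_int_def)
      thus "poly (monom (lp_coeff D m) (nat (m - N))) y * y powi N = lp_coeff D m * y powi m"
        using y by (simp add: poly_monom power_int_diff flip: \<open>_ = y ^ nat (m - N)\<close>)
    qed auto
    also have "\<dots> = 0"
      using eq[OF that] by (simp add: D_def flip: lp_eval_def) (simp add: lp_eval_diff)
    finally show ?thesis
      using y by simp
  qed
  hence "Y \<subseteq> {y. poly P y = 0}"
    by auto
  hence "P = 0"
    using assms(1) poly_roots_finite finite_subset by blast
  have "lp_coeff D m = 0" for m
  proof (rule ccontr)
    assume "lp_coeff D m \<noteq> 0"
    hence m: "m \<in> Poly_Mapping.keys D"
      by (simp add: in_keys_iff)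
    have "coeff P (nat (m - N)) =
        (\<Sum>i\<in>Poly_Mapping.keys D. if i = m then lp_coeff D i else 0)"
      unfolding P_def coeff_sum coeff_monom
      by (rule sum.cong) (use N m in \<open>auto simp: nat_eq_iff2\<close>)
    also have "\<dots> = lp_coeff D m"
      using m by simp
    finally show False
      using \<open>P = 0\<close> \<open>lp_coeff D m \<noteq> 0\<close> by simp
  qed
  hence "D = 0"
    by (intro poly_mapping_eqI) simp
  thus ?thesis
    by (simp add: D_def)
qed

section \<open>Powers of \<open>q\<close>\<close>

lemma qexp_nonzero [simp]: "qexp n \<alpha> \<noteq> 0"
  by (simp add: qexp_def power_int_eq_0_iff)

lemma qexp_add_of_int:
  assumes "qexp_in_field n \<alpha>"
  shows "qexp n (\<alpha> + of_int b) = qexp n \<alpha> * (qroot ^ n) powi b"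
proof -
  obtain z where z: "of_nat n * \<alpha> = of_int z"
    using assms by (auto simp: qexp_in_field_def elim: Ints_cases)
  have "of_nat n * (\<alpha> + of_int b) = of_int (z + int n * b)"
    using z by (simp add: distrib_left)
  hence "\<lfloor>of_nat n * (\<alpha> + of_int b)\<rfloor> = z + int n * b"
    by (metis floor_of_int)
  thus ?thesis
    using z by (simp add: qexp_def power_int_add power_int_mult)
qed

lemma qexp_diff_of_nat:
  assumes "qexp_in_field n \<alpha>"
  shows "qexp n (\<alpha> - of_nat j) = qexp n \<alpha> * (qroot ^ n) powi (- int j)"
  using qexp_add_of_int[OF assms, of "- int j"] by simp

lemma qexp_uminus_of_nat: "qexp n (- of_nat j) = (qroot ^ n) powi (- int j)"
  using qexp_of_int[of n "- int j"] by simp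

text \<open>
  \<open>qroot\<close> is not a root of unity: if \<open>qroot\<^sup>m = 1\<close>, then \<open>1\<close> is a \<open>b\<close>-th root of
  \<open>qroot\<^sup>m\<close> for all \<open>b\<close>, so all \<open>b\<close> divide \<open>m\<close>.
\<close>

lemma infinite_powers_of_q:
  assumes "n > 0"
  shows "infinite (range (\<lambda>k::int. qexp n (of_int k) :: 'k::field ratfun))"
proof -
  have no_unity: "m = 0" if "(qroot :: 'k ratfun) ^ m = 1" for m :: nat
  proof -
    have "(1 :: 'k ratfun) ^ Suc m = qroot ^ m" using that by simp
    hence "Suc m dvd m" by (rule root_of_qroot_power)
    thus ?thesis using dvd_imp_le[of "Suc m" m] by (cases m) simp_all
  qed
  have less: False if "k < l" "(qexp n (of_int k) :: 'k ratfun) = qexp n (of_int l)" for k l :: int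
  proof -
    have "((qroot :: 'k ratfun) ^ n) powi (l - k) = 1"
      using that by (simp add: qexp_of_int power_int_diff)
    hence "(qroot :: 'k ratfun) ^ (n * nat (l - k)) = 1"
      using that by (simp add: power_int_def power_mult)
    from no_unity[OF this] show False
      using that assms by simp
  qed
  have "inj (\<lambda>k::int. qexp n (of_int k) :: 'k ratfun)"
  proof (rule injI)
    fix k l :: int
    assume "(qexp n (of_int k) :: 'k ratfun) = qexp n (of_int l)"
    thus "k = l"
      using less[of k l] less[of l k] by (cases k l rule: linorder_cases) auto
  qed
  thus ?thesis
    using finite_imageD infinite_UNIV_int by blast
qed

section \<open>The symmetric spaces\<close>

lemma S_set_iff:
  "Q \<in> S_set n \<alpha> \<beta> c \<longleftrightarrow>
     (\<forall>m. lp_coeff Q m * qexp n \<alpha> powi m = c * (lp_coeff Q (- m) * qexp n \<beta> powi (- m)))"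
  by (simp add: S_set_def poly_mapping_eq_iff fun_eq_iff lp_coeff_subst lp_coeff_const_mult)

lemma zero_in_S_set: "0 \<in> S_set n \<alpha> \<beta> c"
  by (simp add: S_set_iff)

lemma add_in_S_set:
  assumes "P \<in> S_set n \<alpha> \<beta> c" "Q \<in> S_set n \<alpha> \<beta> c"
  shows "P + Q \<in> S_set n \<alpha> \<beta> c"
  using assms by (simp add: S_set_iff lookup_add algebra_simps)

lemma const_mult_in_S_set:
  assumes "P \<in> S_set n \<alpha> \<beta> c"
  shows "lp_const b * P \<in> S_set n \<alpha> \<beta> c"
  using assms by (simp add: S_set_iff lp_coeff_const_mult mult.assoc mult.left_commute[of b])

lemma diff_in_S_set:
  assumes "P \<in> S_set n \<alpha> \<beta> c" "Q \<in> S_set n \<alpha> \<beta> c"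
  shows "P - Q \<in> S_set n \<alpha> \<beta> c"
  using assms by (simp add: S_set_iff lookup_minus algebra_simps)

lemma S_set_coeff_uminus_eq_0:
  assumes "Q \<in> S_set n \<alpha> \<beta> c" "lp_coeff Q (- m) = 0"
  shows "lp_coeff Q m = 0"
proof -
  have "lp_coeff Q m * qexp n \<alpha> powi m = 0"
    using assms by (simp add: S_set_iff)
  thus ?thesis by (simp add: power_int_eq_0_iff)
qed

text \<open>
  For \<open>s > 0\<close> the element is \<open>x\<^sup>s + d (q\<^sup>\<alpha>\<^sup>+\<^sup>\<beta>)\<^sup>s x\<^sup>-\<^sup>s\<close>. For \<open>s = 0\<close> the symmetry says \<open>1 = d\<close>
  for a nonzero constant term, so no element has highest degree \<open>0\<close> unless \<open>d = 1\<close>; this is the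
  only source of the distinction between the two degree bounds of the theorem.
\<close>

lemma S_set_has_degree:
  fixes d :: "'k::field ratfun"
  assumes d: "d \<in> {1, -1}" and s: "s > 0 \<or> s = 0 \<and> d = 1"
  obtains p where "p \<in> S_set n \<alpha> \<beta> d" "lp_coeff p s = 1" "\<And>m. m > s \<Longrightarrow> lp_coeff p m = 0"
proof (cases "s = 0")
  case True
  show thesis
    by (rule that[of 1])
       (use True s in \<open>auto simp: S_set_iff lookup_one when_def\<close>)
next
  case False
  hence s: "s > 0" using s by auto
  let ?u = "d * (qexp n \<alpha> powi s * qexp n \<beta> powi s)"
  let ?p = "Poly_Mapping.single s 1 + Poly_Mapping.single (- s) ?u"
  have dd: "d * d = 1" using d by auto
  have p: "lp_coeff ?p m = (if m = s then 1 else if m = - s then ?u else 0)" for m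
    using s by (auto simp: lookup_add lookup_single when_def)
  show thesis
  proof (rule that[of ?p])
    have "1 * qexp n \<alpha> powi s = d * (?u * qexp n \<beta> powi (- s))"
      using dd by (simp add: power_int_minus power_int_eq_0_iff flip: mult.assoc)
    moreover have "?u * qexp n \<alpha> powi (- s) = d * (1 * qexp n \<beta> powi s)"
      by (simp add: power_int_minus power_int_eq_0_iff)
    ultimately show "?p \<in> S_set n \<alpha> \<beta> d"
      unfolding S_set_iff p using s by auto
  qed (use s in \<open>simp_all only: p, simp_all\<close>)
qed

section \<open>The operator \<open>L\<^sup>*\<close>\<close>

lemma L_star_eq:
  "L_star n J a p = (\<Sum>i\<le>J. lp_subst (qexp n (- of_nat i)) 1 (a i * p))"
  by (simp add: L_star_def lp_subst_mult)

lemma L_star_add: "L_star n J a (p + p') = L_star n J a p + L_star n J a p'"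
  by (simp add: L_star_def lp_subst_add distrib_left sum.distrib)

lemma L_star_const_mult: "L_star n J a (lp_const b * p) = lp_const b * L_star n J a p"
  by (simp add: L_star_def lp_subst_const_mult sum_distrib_left mult.left_commute)

text \<open>Partibility is stated at the points \<open>x = q\<^sup>k\<close>, which are enough to give an identity in \<open>x\<close>.\<close>

lemma q_power_partible_lp:
  fixes a :: "nat \<Rightarrow> 'k::field ratfun laurent"
  assumes "n > 0" "q_power_partible n J a \<gamma> \<epsilon>" "i \<le> J"
  shows "lp_subst (qexp n \<gamma>) 1 (a i) =
         lp_const \<epsilon> * lp_subst (qexp n (\<gamma> - of_nat J)) (-1) (a (J - i))"
proof (rule lp_eqI_eval[OF infinite_powers_of_q[OF assms(1)]])
  fix y assume "y \<in> range (\<lambda>k::int. qexp n (of_int k) :: 'k ratfun)"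
  then obtain k :: int where y: "y = qexp n (of_int k)" by auto
  have "y powi (-1) = qexp n (of_int (- k))"
    by (simp add: y qexp_of_int power_int_minus del: of_int_minus)
  thus "lp_eval (lp_subst (qexp n \<gamma>) 1 (a i)) y =
      lp_eval (lp_const \<epsilon> * lp_subst (qexp n (\<gamma> - of_nat J)) (-1) (a (J - i))) y"
    using assms(2,3) by (simp add: q_power_partible_def lp_eval_subst lp_eval_const_mult y)
qed auto

text \<open>
  With \<open>g = q\<^sup>\<gamma>\<close>, the symmetries of \<open>a\<^sub>i\<close> and of \<open>p\<close> turn
  \<open>(a\<^sub>i p)(q\<^sup>-\<^sup>i g x)\<close> into \<open>\<epsilon> d (a\<^sub>J\<^sub>-\<^sub>i p)(q\<^sup>-\<^sup>J\<^sup>+\<^sup>i g x\<^sup>-\<^sup>1)\<close>, so, up to the factor \<open>\<epsilon> d\<close>, the reflection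
  exchanges the summands with the indices \<open>i\<close> and \<open>J - i\<close>.
\<close>

lemma L_star_in_S_set:
  fixes a :: "nat \<Rightarrow> 'k::field ratfun laurent"
  assumes n: "n > 0" and g: "qexp_in_field n \<gamma>" and part: "q_power_partible n J a \<gamma> \<epsilon>"
    and p: "p \<in> S_set n \<gamma> (\<gamma> - of_nat J) d"
  shows "L_star n J a p \<in> S_set n \<gamma> \<gamma> (\<epsilon> * d)"
proof -
  let ?g = "qexp n \<gamma> :: 'k ratfun" and ?h = "qexp n (\<gamma> - of_nat J) :: 'k ratfun"
  let ?u = "\<lambda>i. qexp n (- of_nat i) :: 'k ratfun"
  have summand: "lp_subst ?g 1 (lp_subst (?u i) 1 (a i * p)) =
      lp_const (\<epsilon> * d) * lp_subst ?g (-1) (lp_subst (?u (J - i)) 1 (a (J - i) * p))"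
    if "i \<le> J" for i
  proof -
    have exps: "?h * inverse (?u i) = ?u (J - i) * ?g"
    proof -
      have "(qroot ^ n) powi (- int J) * inverse ((qroot ^ n) powi (- int i)) =
          ((qroot :: 'k ratfun) ^ n) powi (- int (J - i))"
        using that by (simp add: of_nat_diff power_int_diff power_int_minus field_simps)
      thus ?thesis
        by (simp add: qexp_diff_of_nat[OF g] qexp_uminus_of_nat mult_ac)
    qed
    have "lp_subst ?g 1 (lp_subst (?u i) 1 (a i * p)) =
        lp_subst (?u i) 1 (lp_subst ?g 1 (a i * p))"
      by (simp add: lp_subst_subst mult.commute)
    also have "lp_subst ?g 1 (a i * p) =
        lp_const (\<epsilon> * d) * lp_subst ?h (-1) (a (J - i) * p)"
      using p q_power_partible_lp[OF n part that]
      by (simp add: S_set_def lp_subst_mult lp_const_mult mult_ac)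
    also have "lp_subst (?u i) 1 (lp_const (\<epsilon> * d) * lp_subst ?h (-1) (a (J - i) * p)) =
        lp_const (\<epsilon> * d) * lp_subst (?h * inverse (?u i)) (-1) (a (J - i) * p)"
      by (simp add: lp_subst_const_mult lp_subst_subst power_int_minus)
    also have "\<dots> = lp_const (\<epsilon> * d) *
        lp_subst ?g (-1) (lp_subst (?u (J - i)) 1 (a (J - i) * p))"
      by (simp add: exps lp_subst_subst)
    finally show ?thesis .
  qed
  have "lp_subst ?g 1 (L_star n J a p) = (\<Sum>i\<le>J. lp_const (\<epsilon> * d) *
      lp_subst ?g (-1) (lp_subst (?u (J - i)) 1 (a (J - i) * p)))"
    unfolding L_star_eq by (simp add: lp_subst_sum summand)
  also have "\<dots> = (\<Sum>i\<le>J. lp_const (\<epsilon> * d) * lp_subst ?g (-1) (lp_subst (?u i) 1 (a i * p)))"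
    by (rule sum.reindex_bij_witness[of _ "\<lambda>i. J - i" "\<lambda>i. J - i"]) auto
  also have "\<dots> = lp_const (\<epsilon> * d) * lp_subst ?g (-1) (L_star n J a p)"
    unfolding L_star_eq by (simp add: lp_subst_sum sum_distrib_left)
  finally show ?thesis
    by (simp add: S_set_def)
qed

text \<open>
  The factor \<open>f_op\<close> arises because the \<open>i\<close>-th summand of \<open>L\<^sup>*\<close> scales \<open>x\<^sup>s\<close> by \<open>q\<^sup>-\<^sup>s\<^sup>i\<close>.
\<close>

lemma L_star_leading_coeff:
  assumes a: "\<And>i m. i \<le> J \<Longrightarrow> m > h \<Longrightarrow> lp_coeff (a i) m = 0"
    and p: "\<And>m. m > s \<Longrightarrow> lp_coeff p m = 0"
  shows "lp_coeff (L_star n J a p) (h + s) = f_op n J a h s * lp_coeff p s"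
    and "m > h + s \<Longrightarrow> lp_coeff (L_star n J a p) m = 0"
proof -
  let ?A = "\<lambda>i. lp_subst (qexp n (- of_nat i)) 1 (a i)"
  let ?P = "\<lambda>i. lp_subst (qexp n (- of_nat i)) 1 p"
  have A: "lp_coeff (?A i) m = 0" if "i \<le> J" "m > h" for i m
    using a[OF that] by (simp add: lp_coeff_subst)
  have P: "lp_coeff (?P i) m = 0" if "m > s" for i m
    using p[OF that] by (simp add: lp_coeff_subst)
  show "lp_coeff (L_star n J a p) m = 0" if "m > h + s"
    unfolding L_star_def lookup_sum
    by (rule sum.neutral) (use lp_coeff_mult_top(2)[OF A P that] in auto)
  have scale: "qexp n (- of_nat i) powi s = qexp n (of_int (- (s * int i)))" for i
    by (simp add: qexp_uminus_of_nat qexp_of_int mult.commute del: of_int_minus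
        flip: power_int_mult)
  have "lp_coeff (L_star n J a p) (h + s) = (\<Sum>i\<le>J. lp_coeff (?A i) h * lp_coeff (?P i) s)"
    unfolding L_star_def lookup_sum
    by (rule sum.cong) (use lp_coeff_mult_top(1)[OF A P] in auto)
  also have "\<dots> = (\<Sum>i\<le>J. lp_coeff (?A i) h * qexp n (of_int (- (s * int i))) * lp_coeff p s)"
    by (rule sum.cong)
       (simp_all add: lp_coeff_subst[of 1 _ p] mult_ac del: of_int_minus of_int_mult flip: scale)
  finally show "lp_coeff (L_star n J a p) (h + s) = f_op n J a h s * lp_coeff p s"
    by (simp add: f_op_def sum_distrib_right)
qed

section \<open>Reduction of the highest degree\<close>

text \<open>
  Elimination from the top: if a linear map attains every highest degree \<open>t \<ge> B\<close> on \<open>W\<close>, its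
  values can be used to cancel all terms of degree at least \<open>B\<close> in a Laurent polynomial.
\<close>

lemma triangular_reduction:
  fixes T :: "'a::field laurent \<Rightarrow> 'a laurent"
  assumes zero: "0 \<in> W"
    and add: "\<And>p p'. p \<in> W \<Longrightarrow> p' \<in> W \<Longrightarrow> p + p' \<in> W"
    and scale: "\<And>b p. p \<in> W \<Longrightarrow> lp_const b * p \<in> W"
    and T_add: "\<And>p p'. T (p + p') = T p + T p'"
    and T_scale: "\<And>b p. T (lp_const b * p) = lp_const b * T p"
    and tops: "\<And>t. t \<ge> B \<Longrightarrow> \<exists>p\<in>W. lp_coeff (T p) t \<noteq> 0 \<and> (\<forall>m>t. lp_coeff (T p) m = 0)"
  shows "\<exists>p\<in>W. \<forall>m\<ge>B. lp_coeff (Q - T p) m = 0"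
proof -
  have step: "\<exists>p\<in>W. \<forall>m\<ge>B. lp_coeff (Q - T p) m = 0"
    if "\<forall>m\<ge>B + int N. lp_coeff Q m = 0" for N Q
    using that
  proof (induction N arbitrary: Q)
    case 0
    have "T 0 + T 0 = T 0"
      by (simp flip: T_add)
    hence "T 0 = 0"
      using add_left_imp_eq[of "T 0" "T 0" 0] by simp
    thus ?case
      using 0 zero by (intro bexI[of _ 0]) auto
  next
    case (Suc N)
    obtain p where p: "p \<in> W" "lp_coeff (T p) (B + int N) \<noteq> 0"
        "\<forall>m>B + int N. lp_coeff (T p) m = 0"
      using tops[of "B + int N"] by auto
    define b where "b = lp_coeff Q (B + int N) / lp_coeff (T p) (B + int N)"
    have "\<forall>m\<ge>B + int N. lp_coeff (Q - T (lp_const b * p)) m = 0"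
    proof (intro allI impI)
      fix m assume "m \<ge> B + int N"
      then consider "m = B + int N" | "m > B + int N" "m \<ge> B + int (Suc N)" by linarith
      thus "lp_coeff (Q - T (lp_const b * p)) m = 0"
        by cases (use p Suc.prems in \<open>auto simp: lookup_minus T_scale lp_coeff_const_mult b_def\<close>)
    qed
    from Suc.IH[OF this] obtain p' where p': "p' \<in> W"
        "\<forall>m\<ge>B. lp_coeff (Q - T (lp_const b * p) - T p') m = 0"
      by auto
    show ?case
      using p p' by (intro bexI[of _ "lp_const b * p + p'"])
        (auto simp: T_add diff_diff_eq intro: add scale)
  qed
  define M where "M = Max (insert B (Poly_Mapping.keys Q))"
  define N where "N = nat (M + 1 - B)"
  have "\<forall>m\<ge>B + int N. lp_coeff Q m = 0"
  proof (intro allI impI, rule ccontr)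
    fix m assume m: "m \<ge> B + int N" "lp_coeff Q m \<noteq> 0"
    hence "m \<le> M"
      unfolding M_def by (intro Max_ge) (auto simp: in_keys_iff)
    thus False
      using m(1) by (simp add: N_def split: if_splits)
  qed
  from step[OF this] show ?thesis .
qed

section \<open>Degrees\<close>

text \<open>A zero coefficient contributes \<open>-\<infinity>\<close> to the highest and \<open>\<infinity>\<close> to the lowest degree,
  so only the union of the supports matters.\<close>

lemma degrees_op_eq:
  fixes a :: "nat \<Rightarrow> 'a::zero laurent" and J :: nat
  defines "U \<equiv> (\<Union>i\<le>J. Poly_Mapping.keys (a i))"
  assumes "U \<noteq> {}"
  shows "hdeg_op J a = Fin (Max U)" and "ldeg_op J a = Fin (Min U)"
proof -
  have fin: "finite U" by (simp add: U_def)
  have nonempty: "Poly_Mapping.keys P \<noteq> {}" if "P \<noteq> 0" for P :: "'a laurent"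
    using that by (metis poly_mapping_eqI in_keys_iff lookup_zero empty_iff)
  have bounds: "Max U \<ge> Max (Poly_Mapping.keys (a i))" "Min U \<le> Min (Poly_Mapping.keys (a i))"
    if "i \<le> J" "a i \<noteq> 0" for i
  proof -
    have "Poly_Mapping.keys (a i) \<subseteq> U"
      using that by (auto simp: U_def)
    thus "Max U \<ge> Max (Poly_Mapping.keys (a i))" "Min U \<le> Min (Poly_Mapping.keys (a i))"
      using nonempty[OF that(2)] fin by (simp_all add: Max_mono Min_antimono del: Max_le_iff Min_ge_iff)
  qed
  show "hdeg_op J a = Fin (Max U)"
    unfolding hdeg_op_def
  proof (rule Max_eqI)
    show "x \<le> Fin (Max U)" if "x \<in> (\<lambda>i. hdeg (a i)) ` {..J}" for x
      using that bounds by (auto simp: hdeg_def)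
    from Max_in[OF fin assms(2)] obtain i where i: "i \<le> J" "Max U \<in> Poly_Mapping.keys (a i)"
      by (auto simp: U_def)
    hence "a i \<noteq> 0" "Max U \<le> Max (Poly_Mapping.keys (a i))" by auto
    hence "hdeg (a i) = Fin (Max U)"
      using order_antisym[OF bounds(1)[of i]] i by (simp only: hdeg_def if_False simp_thms)
    thus "Fin (Max U) \<in> (\<lambda>i. hdeg (a i)) ` {..J}"
      using i by force
  qed auto
  show "ldeg_op J a = Fin (Min U)"
    unfolding ldeg_op_def
  proof (rule Min_eqI)
    show "x \<ge> Fin (Min U)" if "x \<in> (\<lambda>i. ldeg (a i)) ` {..J}" for x
      using that bounds by (auto simp: ldeg_def)
    from Min_in[OF fin assms(2)] obtain i where i: "i \<le> J" "Min U \<in> Poly_Mapping.keys (a i)"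
      by (auto simp: U_def)
    hence "a i \<noteq> 0" "Min U \<ge> Min (Poly_Mapping.keys (a i))" by auto
    hence "ldeg (a i) = Fin (Min U)"
      using order_antisym[OF bounds(2)[of i]] i by (simp only: ldeg_def if_False simp_thms)
    thus "Fin (Min U) \<in> (\<lambda>i. ldeg (a i)) ` {..J}"
      using i by force
  qed auto
qed

text \<open>
  Partibility pairs the monomial \<open>x\<^sup>m\<close> of \<open>a\<^sub>i\<close> with the monomial \<open>x\<^sup>-\<^sup>m\<close> of \<open>a\<^sub>J\<^sub>-\<^sub>i\<close>, so the lowest
  degree of \<open>L\<close> is the negative of the highest.
\<close>

lemma q_power_partible_degree:
  fixes a :: "nat \<Rightarrow> 'k::field ratfun laurent"
  assumes n: "n > 0" and part: "q_power_partible n J a \<gamma> \<epsilon>"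
  obtains h where "hdeg_op J a = Fin h" "deg_op J a = Fin (2 * h)"
    "\<And>i m. i \<le> J \<Longrightarrow> m > h \<Longrightarrow> lp_coeff (a i) m = 0"
proof -
  define U where "U = (\<Union>i\<le>J. Poly_Mapping.keys (a i))"
  have fin: "finite U" by (simp add: U_def)
  have "\<exists>m. lp_coeff (a 0) m \<noteq> 0"
    using part by (metis q_power_partible_def poly_mapping_eqI lookup_zero)
  hence ne: "U \<noteq> {}"
    unfolding U_def by (metis UN_I atMost_iff empty_iff in_keys_iff zero_le)
  have sym: "- m \<in> U" if "m \<in> U" for m
  proof -
    from that obtain i where i: "i \<le> J" "lp_coeff (a i) m \<noteq> 0"
      by (auto simp: U_def in_keys_iff)
    have "lp_coeff (a i) m * qexp n \<gamma> powi m =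
        \<epsilon> * (lp_coeff (a (J - i)) (- m) * qexp n (\<gamma> - of_nat J) powi (- m))"
      using arg_cong[OF q_power_partible_lp[OF n part i(1)], of "\<lambda>P. lp_coeff P m"]
      by (simp add: lp_coeff_subst lp_coeff_const_mult)
    hence "lp_coeff (a (J - i)) (- m) \<noteq> 0"
      using i by (auto simp: power_int_eq_0_iff)
    thus ?thesis
      by (auto simp: U_def in_keys_iff intro!: bexI[of _ "J - i"])
  qed
  have "Min U = - Max U"
  proof (rule Min_eqI[OF fin])
    show "y \<ge> - Max U" if "y \<in> U" for y
      using Max_ge[OF fin sym[OF that]] by linarith
  qed (use sym Max_in[OF fin ne] in auto)
  hence "hdeg_op J a = Fin (Max U)" "deg_op J a = Fin (2 * Max U)"
    using degrees_op_eq[of a J] ne by (simp_all flip: U_def add: deg_op_def minus_extended_def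
        del: minus_Min_eq_Max minus_Max_eq_Min)
  moreover have "lp_coeff (a i) m = 0" if "i \<le> J" "m > Max U" for i m
  proof (rule ccontr)
    assume "lp_coeff (a i) m \<noteq> 0"
    hence "m \<in> U" using that by (auto simp: U_def in_keys_iff)
    thus False using Max_ge[OF fin] that by fastforce
  qed
  ultimately show thesis
    using that by blast
qed

lemma deg_symmetric_bound:
  assumes Q: "Q \<in> S_set n \<alpha> \<beta> c" and top: "\<forall>m\<ge>B. lp_coeff Q m = 0"
  shows "deg Q \<le> Fin (2 * (B - 1))"
proof (cases "Q = 0")
  case True
  thus ?thesis by (simp add: deg_def hdeg_def ldeg_def minus_extended_def)
next
  case False
  let ?K = "Poly_Mapping.keys Q"
  have ne: "?K \<noteq> {}"
    using False by (metis poly_mapping_eqI in_keys_iff lookup_zero empty_iff)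
  have "m \<le> B - 1" "- m \<le> B - 1" if "m \<in> ?K" for m
    using that top S_set_coeff_uminus_eq_0[OF Q, of m]
    by (force simp: in_keys_iff not_le[symmetric])+
  hence "Max ?K \<le> B - 1" "- Min ?K \<le> B - 1"
    using Max_in[OF finite_keys ne] Min_in[OF finite_keys ne] by blast+
  hence "Max ?K - Min ?K \<le> 2 * (B - 1)"
    unfolding diff_conv_add_uminus[of "Max ?K"] mult_2 by (rule add_mono)
  thus ?thesis
    using False by (simp add: deg_def hdeg_def ldeg_def minus_extended_def del: minus_Min_eq_Max)
qed

section \<open>Division by \<open>L\<^sup>*\<close>\<close>

theorem theorem5:
  fixes n J :: nat
    and \<gamma> :: rat
    and c \<epsilon> :: "'k::field_char_0 ratfun"
    and a :: "nat \<Rightarrow> 'k ratfun laurent"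
    and Q :: "'k ratfun laurent"
  assumes "n > 0"
    and "c \<in> {1, -1}" and "\<epsilon> \<in> {1, -1}"
    and "qexp_in_field n \<gamma>"
    and "nondegenerated n J a"
    and "q_power_partible n J a \<gamma> \<epsilon>"
    and "Q \<in> S_set n \<gamma> \<gamma> c"
  shows "\<exists>p \<in> S_set n \<gamma> (\<gamma> - of_nat J) (c * \<epsilon>). \<exists>Qt \<in> S_set n \<gamma> \<gamma> c.
           deg Qt \<le> deg_op J a \<and> Q = L_star n J a p + Qt \<and>
           (c * \<epsilon> = 1 \<longrightarrow> deg Qt < deg_op J a)"
proof -
  obtain h where h: "hdeg_op J a = Fin h" and deg_op: "deg_op J a = Fin (2 * h)"
    and a_top: "\<And>i m. i \<le> J \<Longrightarrow> m > h \<Longrightarrow> lp_coeff (a i) m = 0"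
    using q_power_partible_degree[OF assms(1,6)] by blast
  have f: "f_op n J a h s \<noteq> 0" for s
    using assms(5) h by (auto simp: nondegenerated_def R_op_def)
  let ?W = "S_set n \<gamma> (\<gamma> - of_nat J) (c * \<epsilon>)"
  have ce: "c * \<epsilon> \<in> {1, -1}" and sign: "\<epsilon> * (c * \<epsilon>) = c"
    using assms(2,3) by auto
  \<comment> \<open>Degree \<open>t\<close> is attained by \<open>L\<^sup>*(p)\<close> with \<open>p\<close> of degree \<open>t - h\<close>, and \<open>t = h\<close> is possible only
      if \<open>1 \<in> ?W\<close>.\<close>
  define B where "B = (if c * \<epsilon> = 1 then h else h + 1)"
  have tops: "\<exists>p\<in>?W. lp_coeff (L_star n J a p) t \<noteq> 0 \<and> (\<forall>m>t. lp_coeff (L_star n J a p) m = 0)"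
    if "t \<ge> B" for t
  proof -
    define s where "s = t - h"
    have t: "t = h + s" by (simp add: s_def)
    have "s > 0 \<or> s = 0 \<and> c * \<epsilon> = 1"
      using that by (auto simp: s_def B_def split: if_splits)
    then obtain p where p: "p \<in> ?W" "lp_coeff p s = 1" and p_top: "\<And>m. m > s \<Longrightarrow> lp_coeff p m = 0"
      using S_set_has_degree[OF ce] by blast
    show ?thesis
      using p f L_star_leading_coeff[where J = J and h = h and a = a and s = s and p = p and n = n,
            OF a_top p_top]
      by (intro bexI[of _ p]) (auto simp: t)
  qed
  have "\<exists>p\<in>?W. \<forall>m\<ge>B. lp_coeff (Q - L_star n J a p) m = 0"
    by (rule triangular_reduction)
       (auto intro: zero_in_S_set add_in_S_set const_mult_in_S_set L_star_add L_star_const_mult tops)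
  then obtain p where p: "p \<in> ?W" and rem: "\<forall>m\<ge>B. lp_coeff (Q - L_star n J a p) m = 0"
    by blast
  have "L_star n J a p \<in> S_set n \<gamma> \<gamma> c"
    using L_star_in_S_set[OF assms(1,4,6) p] by (simp only: sign)
  hence Qt: "Q - L_star n J a p \<in> S_set n \<gamma> \<gamma> c"
    by (rule diff_in_S_set[OF assms(7)])
  have "deg (Q - L_star n J a p) \<le> Fin (2 * (B - 1))"
    by (rule deg_symmetric_bound[OF Qt rem])
  moreover have "Fin (2 * (B - 1)) \<le> deg_op J a"
    and "c * \<epsilon> = 1 \<Longrightarrow> Fin (2 * (B - 1)) < deg_op J a"
    by (auto simp: deg_op B_def)
  ultimately have "deg (Q - L_star n J a p) \<le> deg_op J a"
    and "c * \<epsilon> = 1 \<Longrightarrow> deg (Q - L_star n J a p) < deg_op J a"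
    by (blast intro: order_trans le_less_trans)+
  with p Qt show ?thesis
    by (intro bexI[of _ p] bexI[of _ "Q - L_star n J a p"]) auto
qed

end
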